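(* Let $p$ be a prime and $\lambda$ a partition. For $a,b\in A_{p,\lambda}$ write $[a]\geq[b]$ if $a$ degenerates to $b$; this is a well-defined relation on the set $G_{p,\lambda}\backslash A_{p,\lambda}$ of $G_{p,\lambda}$-orbits in $A_{p,\lambda}$. The relation $\geq$ is a partial order on $G_{p,\lambda}\backslash A_{p,\lambda}$. The map $\phi:G_{p,\lambda}\backslash A_{p,\lambda}\to J(P_\lambda)$ given by $\phi([a])=I_\lambda(a)$ is an isomorphism of posets.
   Context: A partition is a non-increasing sequence $\lambda=(\lambda_1\geq\cdots\geq\lambda_l)$ of positive integers; $A_{p,\lambda}=\mathbf{Z}/p^{\lambda_1}\mathbf{Z}\oplus\cdots\oplus\mathbf{Z}/p^{\lambda_l}\mathbf{Z}$; $G_{p,\lambda}$ is the automorphism group of $A_{p,\lambda}$; $[a]$ denotes the $G_{p,\lambda}$-orbit of $a\in A_{p,\lambda}$. If $A$ and $B$ are groups, $a\in A$, $b\in B$, then $a$ degenerates to $b$ if there is a homomorphism $\phi:A\to B$ with $\phi(a)=b$. Fundamental poset $P$: its elements are the symbols $(p^r,k)$ with integers $0\leq r<k$, where $(p^r,k)$ denotes the orbit of $p^r$ in $\mathbf{Z}/p^k\mathbf{Z}$ under automorphisms of $\mathbf{Z}/p^k\mathbf{Z}$, i.e. the set of elements $p^ru$ with $p\nmid u$. The partial order is degeneration: $(p^r,k)\geq(p^s,l)$ if and only if $p^r\in\mathbf{Z}/p^k\mathbf{Z}$ degenerates to $p^s\in\mathbf{Z}/p^l\mathbf{Z}$, equivalently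 $r\leq s$ and $k-r\geq l-s$. $P_\lambda$ is the induced subposet of $P$ consisting of the elements $(p^r,k)$ with $k=\lambda_i$ for some $i$. An ideal of a poset is a (possibly empty) down-closed subset. $J(P_\lambda)$ is the lattice of ideals of $P_\lambda$, ordered by inclusion. For $a=(a_1,\ldots,a_l)\in A_{p,\lambda}$, $I(a)$ is the ideal of $P$ generated by the orbits of the non-zero coordinates $a_i\in\mathbf{Z}/p^{\lambda_i}\mathbf{Z}$ ($a_i=p^ru\neq0$ with $p\nmid u$ contributes $(p^r,\lambda_i)$), and $I_\lambda(a)=I(a)\cap P_\lambda$. *)

theory Defs
  imports
    HOL.Hull
    "HOL-Algebra.Product_Groups"
    "HOL-Algebra.Group_Action"
    "HOL-Computational_Algebra.Primes"
begin

(* The empty list is allowed as the partition of 0. *)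
definition is_partition :: "nat list \<Rightarrow> bool" where
  "is_partition lam \<longleftrightarrow> sorted_wrt (\<ge>) lam \<and> (\<forall>k\<in>set lam. 0 < k)"

(* Coordinates are indexed from 0, and residues are represented by integers in {0..<p ^ k}. *)
definition A_grp :: "nat \<Rightarrow> nat list \<Rightarrow> (nat \<Rightarrow> int) monoid" where
  "A_grp p lam = product_group {..<length lam} (\<lambda>i. integer_mod_group (p ^ (lam ! i)))"

definition G_orbit :: "nat \<Rightarrow> nat list \<Rightarrow> (nat \<Rightarrow> int) \<Rightarrow> (nat \<Rightarrow> int) set" where
  "G_orbit p lam a = orbit (AutoGroup (A_grp p lam)) (\<lambda>f. f) a"

definition G_orbits :: "nat \<Rightarrow> nat list \<Rightarrow> (nat \<Rightarrow> int) set set" where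
  "G_orbits p lam = orbits (AutoGroup (A_grp p lam)) (carrier (A_grp p lam)) (\<lambda>f. f)"

definition degenerates ::
    "('a, 'c) monoid_scheme \<Rightarrow> 'a \<Rightarrow> ('b, 'd) monoid_scheme \<Rightarrow> 'b \<Rightarrow> bool" where
  "degenerates A a B b \<longleftrightarrow> (\<exists>h\<in>hom A B. h a = b)"

(* Degeneration of orbits by means of some pair of representatives. *)
definition orbit_ge :: "nat \<Rightarrow> nat list \<Rightarrow> (nat \<Rightarrow> int) set \<Rightarrow> (nat \<Rightarrow> int) set \<Rightarrow> bool" where
  "orbit_ge p lam X Y \<longleftrightarrow>
     (\<exists>a\<in>X. \<exists>b\<in>Y. degenerates (A_grp p lam) a (A_grp p lam) b)"

(* The symbol (p^r, k) is the pair of natural numbers (p ^ r, k), not (r, k). *)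
definition fund_poset :: "nat \<Rightarrow> (nat \<times> nat) set" where
  "fund_poset p = {(p ^ r, k) | r k. r < k}"

definition fund_ge :: "nat \<Rightarrow> nat \<times> nat \<Rightarrow> nat \<times> nat \<Rightarrow> bool" where
  "fund_ge p = (\<lambda>(x, k) (y, l).
     degenerates (integer_mod_group (p ^ k)) (int x) (integer_mod_group (p ^ l)) (int y))"

definition fund_poset_part :: "nat \<Rightarrow> nat list \<Rightarrow> (nat \<times> nat) set" where
  "fund_poset_part p lam = {(x, k) \<in> fund_poset p. k \<in> set lam}"

definition is_ideal :: "'a set \<Rightarrow> ('a \<Rightarrow> 'a \<Rightarrow> bool) \<Rightarrow> 'a set \<Rightarrow> bool" where
  "is_ideal P ge I \<longleftrightarrow> I \<subseteq> P \<and> (\<forall>x\<in>I. \<forall>y\<in>P. ge x y \<longrightarrow> y \<in> I)"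

definition J_lattice :: "nat \<Rightarrow> nat list \<Rightarrow> (nat \<times> nat) set set" where
  "J_lattice p lam = {I. is_ideal (fund_poset_part p lam) (fund_ge p) I}"

definition coord_orbits :: "nat \<Rightarrow> nat list \<Rightarrow> (nat \<Rightarrow> int) \<Rightarrow> (nat \<times> nat) set" where
  "coord_orbits p lam a =
     {(p ^ r, lam ! i) | i r u. i < length lam \<and> a i \<noteq> 0 \<and> a i = int p ^ r * u \<and> \<not> int p dvd u}"

definition ideal_of :: "nat \<Rightarrow> nat list \<Rightarrow> (nat \<Rightarrow> int) \<Rightarrow> (nat \<times> nat) set" where
  "ideal_of p lam a = is_ideal (fund_poset p) (fund_ge p) hull coord_orbits p lam a"

definition ideal_of_part :: "nat \<Rightarrow> nat list \<Rightarrow> (nat \<Rightarrow> int) \<Rightarrow> (nat \<times> nat) set" where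
  "ideal_of_part p lam a = ideal_of p lam a \<inter> fund_poset_part p lam"

end

(* For s < l, the symbol (p^s, l) lies in I(a) exactly when p^(l-s-1) a is not divisible by p^l
   in the whole group.  This description is visibly preserved by homomorphisms, so a degeneration
   a -> b gives I(b) <= I(a).  Conversely, each ideal I has a canonical element c(I) whose i-th
   coordinate is p^r with r least such that (p^r, lambda_i) lies in I (or 0 if there is none).
   Elementary automorphisms x_i := u x_i + d x_j carry a to c(I(a)) one coordinate at a time, and
   for I <= J the element c(J) degenerates to c(I) by a diagonal homomorphism. *)
theory Submission
  imports Defs
begin

section \<open>Generated ideals and divisibility by prime powers\<close>

text \<open>Reflexivity puts \<open>S\<close> into the set on the right, transitivity makes that set
  down-closed, and every ideal containing \<open>S\<close> contains it. This replaces the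
  intersection behind \<open>hull\<close> by an explicit condition.\<close>

lemma hull_is_ideal:
  assumes "S \<subseteq> P" "\<And>x. x \<in> P \<Longrightarrow> ge x x"
    and trans: "\<And>x y z. \<lbrakk>x \<in> P; y \<in> P; z \<in> P; ge x y; ge y z\<rbrakk> \<Longrightarrow> ge x z"
  shows "is_ideal P ge hull S = {y \<in> P. \<exists>x\<in>S. ge x y}"
proof (rule hull_unique)
  show "is_ideal P ge {y \<in> P. \<exists>x\<in>S. ge x y}"
    unfolding is_ideal_def using assms(1) trans by blast
  show "S \<subseteq> {y \<in> P. \<exists>x\<in>S. ge x y}"
    using assms(1,2) by blast
  show "{y \<in> P. \<exists>x\<in>S. ge x y} \<subseteq> T" if "S \<subseteq> T" "is_ideal P ge T" for T
    using that unfolding is_ideal_def by blast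
qed

lemma prime_power_decompose_int:
  fixes p :: nat and x :: int
  assumes "prime p" "x \<noteq> 0"
  obtains r u where "x = int p ^ r * u" "\<not> int p dvd u"
proof -
  have "\<not> is_unit (int p)"
    using prime_gt_1_nat[OF assms(1)] by simp
  with assms(2) show ?thesis
    using that by (rule multiplicity_decompose')
qed

lemma prime_power_dvd_power_times_iff:
  fixes p :: nat and u :: int
  assumes "prime p" "\<not> int p dvd u"
  shows "int p ^ m dvd int p ^ n * u \<longleftrightarrow> m \<le> n"
proof
  assume "int p ^ m dvd int p ^ n * u"
  moreover have "coprime (int p ^ m) u"
    using assms by (simp add: prime_imp_coprime)
  ultimately have "int p ^ m dvd int p ^ n"
    by (simp add: coprime_dvd_mult_left_iff)
  then have "p ^ m dvd p ^ n"
    by (metis of_nat_dvd_iff of_nat_power)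
  then show "m \<le> n"
    using assms(1) by (metis power_dvd_imp_le prime_gt_1_nat)
qed (simp add: le_imp_power_dvd)

section \<open>Homomorphisms of cyclic groups and the order on P\<close>

text \<open>Reducing \<open>x\<close> modulo \<open>k\<close> changes \<open>d * x\<close> by a
  multiple of \<open>d * k\<close>, hence of \<open>l\<close>. So multiplication by \<open>d\<close>
  is well defined from Z/k to Z/l.\<close>

lemma mult_mod_cong_of_dvd:
  fixes d :: int
  assumes "l dvd d * k"
  shows "d * (x mod k) mod l = d * x mod l"
proof -
  have "k dvd x mod k - x"
    by (simp flip: mod_eq_dvd_iff)
  then have "l dvd d * (x mod k - x)"
    using assms by (meson dvd_trans dvd_refl mult_dvd_mono)
  then show ?thesis
    by (simp add: mod_eq_dvd_iff right_diff_distrib)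
qed

lemma hom_integer_mod_group_mult:
  assumes "l > 0" "int l dvd d * int k"
  shows "(\<lambda>x. d * x mod int l) \<in> hom (integer_mod_group k) (integer_mod_group l)"
proof (rule homI)
  fix x y
  have "d * ((x + y) mod int k) mod int l = d * (x + y) mod int l"
    using mult_mod_cong_of_dvd[OF assms(2)] .
  then show "d * (x \<otimes>\<^bsub>integer_mod_group k\<^esub> y) mod int l =
      d * x mod int l \<otimes>\<^bsub>integer_mod_group l\<^esub> (d * y mod int l)"
    by (simp add: distrib_left mod_simps)
qed (use assms in \<open>simp add: carrier_integer_mod_group\<close>)

text \<open>A homomorphism is multiplication by \<open>h 1\<close>, which forces r \<le> s; since
  p^(k-r) annihilates p^r in Z/p^k, it also annihilates the image p^s, which forces l \<le> k - r +
  s. The second inequality is k - r \<ge> l - s, written without truncated subtraction.\<close>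

lemma fund_ge_iff:
  assumes p: "prime p" and "r < k" "s < l"
  shows "fund_ge p (p ^ r, k) (p ^ s, l) \<longleftrightarrow> r \<le> s \<and> l + r \<le> k + s"
proof
  have p1: "1 < p" using p by (rule prime_gt_1_nat)
  have p_not: "\<not> int p dvd 1" using p1 by simp
  have lt: "int p ^ r < int p ^ k" "int p ^ s < int p ^ l"
    using assms p1 by (auto intro: power_strict_increasing)
  {
    assume "fund_ge p (p ^ r, k) (p ^ s, l)"
    then obtain h where h: "h \<in> hom (integer_mod_group (p ^ k)) (integer_mod_group (p ^ l))"
      and hr: "h (int p ^ r) = int p ^ s"
      by (auto simp: fund_ge_def degenerates_def)
    have pow: "h (int m * x mod int p ^ k) = int m * h x mod int p ^ l"
      if "0 \<le> x" "x < int p ^ k" for m x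
      using hom_nat_pow[OF h _ group_integer_mod_group group_integer_mod_group, of x m] that p1
      by (simp add: carrier_integer_mod_group)
    have one: "(1::int) < int p ^ k" using p1 assms by simp
    have "int p ^ s = h (int (p ^ r) * 1 mod int p ^ k)"
      using hr lt by simp
    also have "\<dots> = int p ^ r * h 1 mod int p ^ l"
      using pow[of 1 "p ^ r"] one by simp
    finally have e: "int p ^ s = int p ^ r * h 1 mod int p ^ l" .
    have "r \<le> s"
    proof (rule ccontr)
      assume "\<not> r \<le> s"
      \<comment> \<open>Because \<open>s < l\<close>, p^(s+1) divides the modulus p^l too, so
        divisibility survives the reduction and contradicts \<open>e\<close>.\<close>
      then have "int p ^ Suc s dvd int p ^ r * h 1 mod int p ^ l"
        using \<open>s < l\<close>
        by (intro dvd_mod dvd_mult2 le_imp_power_dvd) auto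
      then show False
        using prime_power_dvd_power_times_iff[OF p p_not, of "Suc s" s] e by simp
    qed
    moreover have "int p ^ (k - r) * int p ^ s mod int p ^ l = 0"
    proof -
      have "int p ^ (k - r) * int p ^ s mod int p ^ l =
          h (int p ^ (k - r) * int p ^ r mod int p ^ k)"
        using pow[of "int p ^ r" "p ^ (k - r)"] lt hr by simp
      also have "int p ^ (k - r) * int p ^ r mod int p ^ k = 0"
        using \<open>r < k\<close> by (simp flip: power_add)
      also have "h 0 = 0"
        using hom_one[OF h] by simp
      finally show ?thesis .
    qed
    then have "int p ^ l dvd int p ^ (k - r + s) * 1"
      by (simp add: power_add dvd_eq_mod_eq_0)
    then have "l \<le> k - r + s"
      using prime_power_dvd_power_times_iff[OF p p_not] by blast
    ultimately show "r \<le> s \<and> l + r \<le> k + s"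
      using \<open>r < k\<close> by auto
  next
    assume le: "r \<le> s \<and> l + r \<le> k + s"
    \<comment> \<open>Multiplication by p^(s-r) sends p^r to p^s; it is well defined because l \<le>
      (s - r) + k.\<close>
    have "(\<lambda>x. int p ^ (s - r) * x mod int (p ^ l)) \<in>
        hom (integer_mod_group (p ^ k)) (integer_mod_group (p ^ l))"
      using p1 le by (intro hom_integer_mod_group_mult)
        (auto simp: le_imp_power_dvd simp flip: power_add)
    moreover have "int p ^ (s - r) * int (p ^ r) mod int (p ^ l) = int (p ^ s)"
      using le lt by (simp flip: power_add)
    ultimately show "fund_ge p (p ^ r, k) (p ^ s, l)"
      by (auto simp: fund_ge_def degenerates_def)
  }
qed

section \<open>Coordinatewise arithmetic in the finite abelian p-group\<close>

lemma carrier_A_grp: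
  assumes "prime p"
  shows "carrier (A_grp p lam) = (\<Pi>\<^sub>E i\<in>{..<length lam}. {0..<int p ^ (lam ! i)})"
  using assms prime_gt_0_nat by (simp add: A_grp_def carrier_integer_mod_group)

lemma mult_A_grp:
  "x \<otimes>\<^bsub>A_grp p lam\<^esub> y = (\<lambda>i\<in>{..<length lam}. (x i + y i) mod int p ^ (lam ! i))"
  by (simp add: A_grp_def)

lemma group_A_grp: "group (A_grp p lam)"
  by (simp add: A_grp_def)

text \<open>The group is additive in content but multiplicative in notation, so powers are scalar
  multiples.\<close>

lemma pow_A_grp:
  fixes m :: nat
  assumes "i < length lam"
  shows "(x [^]\<^bsub>A_grp p lam\<^esub> m) i = int m * x i mod int p ^ (lam ! i)"
proof (induction m)
  case 0
  show ?case using assms by (simp add: A_grp_def)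
next
  case (Suc m)
  then show ?case
    using assms by (simp add: mult_A_grp mod_simps algebra_simps)
qed

lemma A_grp_range:
  assumes "prime p" "a \<in> carrier (A_grp p lam)" "i < length lam"
  shows "0 \<le> a i" "a i < int p ^ (lam ! i)"
  using assms by (auto simp: carrier_A_grp PiE_iff)

text \<open>A non-zero representative is positive, so its divisor p^r is at most \<open>a i\<close>,
  which is below p^(lam_i). Hence the symbols contributed by coordinates really lie in P.\<close>

lemma coord_exponent_less:
  assumes p: "prime p" and "a \<in> carrier (A_grp p lam)" "i < length lam" "a i \<noteq> 0"
    and "a i = int p ^ r * u"
  shows "r < lam ! i"
proof -
  have "int p ^ r \<le> a i"
    using assms(4,5) A_grp_range(1)[OF assms(1-3)]
    by (metis zdvd_imp_le dvd_triv_left le_less)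
  also have "\<dots> < int p ^ (lam ! i)"
    using assms A_grp_range by blast
  finally show ?thesis
    using p prime_gt_1_nat by (simp add: power_less_imp_less_exp)
qed

section \<open>Membership in the ideal of an element\<close>

lemma in_ideal_of_part_iff:
  assumes p: "prime p" and a: "a \<in> carrier (A_grp p lam)"
  shows "(p ^ s, l) \<in> ideal_of_part p lam a \<longleftrightarrow> s < l \<and> l \<in> set lam \<and>
    (\<exists>j r u. j < length lam \<and> a j \<noteq> 0 \<and> a j = int p ^ r * u \<and> \<not> int p dvd u \<and>
       r \<le> s \<and> l + r \<le> lam ! j + s)"
proof -
  have P: "(p ^ r, k) \<in> fund_poset p \<longleftrightarrow> r < k" for r k
    using p prime_gt_1_nat by (auto simp: fund_poset_def)
  have "ideal_of p lam a = {y \<in> fund_poset p. \<exists>x\<in>coord_orbits p lam a. fund_ge p x y}"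
    unfolding ideal_of_def
  proof (rule hull_is_ideal)
    show "coord_orbits p lam a \<subseteq> fund_poset p"
      using coord_exponent_less[OF p a] by (fastforce simp: coord_orbits_def fund_poset_def)
  qed (auto simp: fund_poset_def fund_ge_iff[OF p])
  then have mem: "(p ^ s, l) \<in> ideal_of_part p lam a \<longleftrightarrow> s < l \<and> l \<in> set lam \<and>
      (\<exists>x\<in>coord_orbits p lam a. fund_ge p x (p ^ s, l))"
    by (auto simp: ideal_of_part_def fund_poset_part_def P)
  have coords: "(\<exists>x\<in>coord_orbits p lam a. fund_ge p x (p ^ s, l)) \<longleftrightarrow>
      (\<exists>j r u. j < length lam \<and> a j \<noteq> 0 \<and> a j = int p ^ r * u \<and> \<not> int p dvd u \<and>
        fund_ge p (p ^ r, lam ! j) (p ^ s, l))"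
    unfolding coord_orbits_def by blast
  have ge: "fund_ge p (p ^ r, lam ! j) (p ^ s, l) \<longleftrightarrow> r \<le> s \<and> l + r \<le> lam ! j + s"
    if "s < l" "j < length lam" "a j \<noteq> 0" "a j = int p ^ r * u" for j r u
    using fund_ge_iff[OF p] coord_exponent_less[OF p a that(2,3,4)] that(1) by blast
  show ?thesis
    unfolding mem coords using ge by (intro conj_cong refl iff_exI) auto
qed

lemma A_grp_eqI:
  assumes "prime p" "x \<in> carrier (A_grp p lam)" "y \<in> carrier (A_grp p lam)"
    and "\<And>i. i < length lam \<Longrightarrow> x i = y i"
  shows "x = y"
  using assms by (auto simp: carrier_A_grp intro: PiE_ext)

text \<open>Put m = l - s - 1. If a_j = p^r u with p not dividing u, then p^m a_j is a multiple of
  p^l in Z/p^(lam_j) iff m + r \<ge> l or m + r \<ge> lam_j, that is, iff r > s or l + r > lam_j +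
  s. Membership says that both fail for some non-zero coordinate. The right-hand side uses only the
  group structure.\<close>

lemma in_ideal_of_part_iff_pow:
  assumes p: "prime p" and a: "a \<in> carrier (A_grp p lam)" and s: "s < l" and l: "l \<in> set lam"
  shows "(p ^ s, l) \<in> ideal_of_part p lam a \<longleftrightarrow>
    \<not> (\<exists>x\<in>carrier (A_grp p lam). a [^]\<^bsub>A_grp p lam\<^esub> (p ^ (l - s - 1)) = x [^]\<^bsub>A_grp p lam\<^esub> (p ^ l))"
proof -
  define m where "m = l - s - 1"
  have m: "l = s + m + 1" using s by (simp add: m_def)
  show ?thesis
  proof
    assume "(p ^ s, l) \<in> ideal_of_part p lam a"
    then obtain j r u where j: "j < length lam" "a j = int p ^ r * u" "\<not> int p dvd u"
      "r \<le> s" "l + r \<le> lam ! j + s"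
      using in_ideal_of_part_iff[OF p a] by blast
    have False if "a [^]\<^bsub>A_grp p lam\<^esub> (p ^ m) = x [^]\<^bsub>A_grp p lam\<^esub> (p ^ l)" for x
    proof -
      have "int p ^ m * a j mod int p ^ (lam ! j) = int p ^ l * x j mod int p ^ (lam ! j)"
        using that j(1) by (metis pow_A_grp of_nat_power)
      \<comment> \<open>Compare both sides modulo p^(m+r+1): this power divides p^l and the modulus,
        but not p^m a_j = p^(m+r) u.\<close>
      moreover have "int p ^ (m + r + 1) dvd int p ^ (lam ! j)" "int p ^ (m + r + 1) dvd int p ^ l"
        using j m by (auto intro!: le_imp_power_dvd simp del: power_Suc)
      ultimately have "int p ^ (m + r + 1) dvd int p ^ m * a j"
        by (metis dvd_mod_iff dvd_mult2)
      then have "int p ^ (m + r + 1) dvd int p ^ (m + r) * u"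
        by (simp add: j(2) power_add mult_ac)
      then show False
        unfolding prime_power_dvd_power_times_iff[OF p j(3)] by simp
    qed
    then show "\<not> (\<exists>x\<in>carrier (A_grp p lam).
        a [^]\<^bsub>A_grp p lam\<^esub> (p ^ (l - s - 1)) = x [^]\<^bsub>A_grp p lam\<^esub> (p ^ l))"
      by (auto simp: m_def)
  next
    assume no_root: "\<not> (\<exists>x\<in>carrier (A_grp p lam).
        a [^]\<^bsub>A_grp p lam\<^esub> (p ^ (l - s - 1)) = x [^]\<^bsub>A_grp p lam\<^esub> (p ^ l))"
    show "(p ^ s, l) \<in> ideal_of_part p lam a"
    proof (rule ccontr)
      assume out: "(p ^ s, l) \<notin> ideal_of_part p lam a"
      have "\<exists>y. int p ^ m * a j mod int p ^ (lam ! j) = int p ^ l * y mod int p ^ (lam ! j)"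
        if j: "j < length lam" for j
      proof (cases "a j = 0")
        case True
        then show ?thesis by (intro exI[of _ 0]) simp
      next
        case False
        then obtain r u where ru: "a j = int p ^ r * u" "\<not> int p dvd u"
          using prime_power_decompose_int[OF p] by blast
        \<comment> \<open>If s < r, then p^m a_j is a multiple of p^l already over the integers;
          otherwise p^m a_j vanishes modulo p^(lam_j) and 0 serves as \<open>y\<close>.\<close>
        then consider "s < r" | "lam ! j + s < l + r"
          using out in_ideal_of_part_iff[OF p a] s l j False by (meson not_le)
        then show ?thesis
        proof cases
          case 1
          then have "int p ^ m * a j = int p ^ l * (int p ^ (r - s - 1) * u)"
            using m by (simp add: ru power_add[symmetric] mult.assoc[symmetric] del: power_Suc)
          then show ?thesis by metis
        next
          case 2
          then have "int p ^ (lam ! j) dvd int p ^ m * a j"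
            using m by (simp add: ru le_imp_power_dvd flip: power_add mult.assoc)
          then show ?thesis by (intro exI[of _ 0]) simp
        qed
      qed
      then obtain y where y: "\<And>j. j < length lam \<Longrightarrow>
          int p ^ m * a j mod int p ^ (lam ! j) = int p ^ l * y j mod int p ^ (lam ! j)"
        by metis
      define x where "x = (\<lambda>j\<in>{..<length lam}. y j mod int p ^ (lam ! j))"
      have x: "x \<in> carrier (A_grp p lam)"
        using p prime_gt_0_nat by (auto simp: x_def carrier_A_grp)
      have "a [^]\<^bsub>A_grp p lam\<^esub> (p ^ m) = x [^]\<^bsub>A_grp p lam\<^esub> (p ^ l)"
      proof (rule A_grp_eqI[OF p])
        show "a [^]\<^bsub>A_grp p lam\<^esub> (p ^ m) \<in> carrier (A_grp p lam)"
          "x [^]\<^bsub>A_grp p lam\<^esub> (p ^ l) \<in> carrier (A_grp p lam)"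
          using a x group_A_grp by (auto intro: monoid.nat_pow_closed group.is_monoid)
      qed (simp add: pow_A_grp y x_def mod_simps)
      with no_root x show False
        by (auto simp: m_def)
    qed
  qed
qed

text \<open>If p^(l-s-1) a = p^l x, then applying \<open>h\<close> gives the same equation for
  \<open>h a\<close> and \<open>h x\<close>, so non-membership passes from \<open>a\<close> to
  \<open>h a\<close>.\<close>

lemma ideal_of_part_hom_mono:
  assumes p: "prime p" and a: "a \<in> carrier (A_grp p lam)"
    and h: "h \<in> hom (A_grp p lam) (A_grp p lam)"
  shows "ideal_of_part p lam (h a) \<subseteq> ideal_of_part p lam a"
proof
  fix z
  assume z: "z \<in> ideal_of_part p lam (h a)"
  then obtain s l where sl: "z = (p ^ s, l)" "s < l" "l \<in> set lam"
    by (auto simp: ideal_of_part_def fund_poset_part_def fund_poset_def)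
  have ha: "h a \<in> carrier (A_grp p lam)"
    using a h by (rule hom_in_carrier[rotated])
  have hpow: "h (x [^]\<^bsub>A_grp p lam\<^esub> n) = h x [^]\<^bsub>A_grp p lam\<^esub> n"
    if "x \<in> carrier (A_grp p lam)" for x and n :: nat
    using hom_nat_pow[OF h that] group_A_grp by blast
  show "z \<in> ideal_of_part p lam a"
  proof (rule ccontr)
    assume "z \<notin> ideal_of_part p lam a"
    then obtain x where x: "x \<in> carrier (A_grp p lam)"
      "a [^]\<^bsub>A_grp p lam\<^esub> (p ^ (l - s - 1)) = x [^]\<^bsub>A_grp p lam\<^esub> (p ^ l)"
      using in_ideal_of_part_iff_pow[OF p a sl(2,3)] sl(1) by blast
    then have "h a [^]\<^bsub>A_grp p lam\<^esub> (p ^ (l - s - 1)) = h x [^]\<^bsub>A_grp p lam\<^esub> (p ^ l)"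
      by (metis hpow a)
    then show False
      using in_ideal_of_part_iff_pow[OF p ha sl(2,3)] z sl(1) x(1) hom_in_carrier[OF h] by blast
  qed
qed

section \<open>Orbits of the automorphism group\<close>

lemma (in group) group_action_AutoGroup: "group_action (AutoGroup G) (carrier G) (\<lambda>f. f)"
proof (intro group_action.intro group_hom.intro group_hom_axioms.intro)
  show "(\<lambda>f. f) \<in> hom (AutoGroup G) (BijGroup (carrier G))"
    by (auto simp: hom_def AutoGroup_def BijGroup_def auto_def)
qed (use AutoGroup group_BijGroup in auto)

interpretation A_action: group_action "AutoGroup (A_grp p lam)" "carrier (A_grp p lam)" "\<lambda>f. f"
  for p lam
  by (rule group.group_action_AutoGroup[OF group_A_grp])

lemma G_orbitE:
  assumes "b \<in> G_orbit p lam a" "a \<in> carrier (A_grp p lam)"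
  obtains h where "h \<in> hom (A_grp p lam) (A_grp p lam)" "b = h a" "b \<in> carrier (A_grp p lam)"
  using assms hom_in_carrier unfolding G_orbit_def orbit_def AutoGroup_def auto_def by fastforce

lemma G_orbit_refl: "a \<in> carrier (A_grp p lam) \<Longrightarrow> a \<in> G_orbit p lam a"
  unfolding G_orbit_def by (rule A_action.orbit_refl)

lemma G_orbit_eq:
  assumes "a \<in> carrier (A_grp p lam)" "b \<in> G_orbit p lam a"
  shows "G_orbit p lam b = G_orbit p lam a"
proof -
  have b: "b \<in> carrier (A_grp p lam)"
    using assms by (auto elim: G_orbitE)
  then have ba: "a \<in> G_orbit p lam b"
    using assms unfolding G_orbit_def by (metis A_action.orbit_sym)
  have "G_orbit p lam y \<subseteq> G_orbit p lam x"
    if "x \<in> carrier (A_grp p lam)" "y \<in> carrier (A_grp p lam)" "y \<in> G_orbit p lam x" for x y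
  proof
    fix z
    assume z: "z \<in> G_orbit p lam y"
    then have "z \<in> carrier (A_grp p lam)"
      using that(2) by (auto elim: G_orbitE)
    with that z show "z \<in> G_orbit p lam x"
      unfolding G_orbit_def by (metis A_action.orbit_trans)
  qed
  with assms b ba show ?thesis by blast
qed

text \<open>An automorphism gives one inclusion, and symmetry of orbits gives the other. Thus the
  ideal is well defined on orbits.\<close>

lemma ideal_of_part_orbit:
  assumes p: "prime p" and a: "a \<in> carrier (A_grp p lam)" and b: "b \<in> G_orbit p lam a"
  shows "ideal_of_part p lam b = ideal_of_part p lam a"
proof -
  have bc: "b \<in> carrier (A_grp p lam)" using a b by (auto elim: G_orbitE)
  have "a \<in> G_orbit p lam b"
    using a b bc unfolding G_orbit_def by (metis A_action.orbit_sym)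
  moreover have "ideal_of_part p lam y \<subseteq> ideal_of_part p lam x"
    if "x \<in> carrier (A_grp p lam)" "y \<in> G_orbit p lam x" for x y
    using ideal_of_part_hom_mono[OF p that(1)] by (metis G_orbitE[OF that(2,1)])
  ultimately show ?thesis
    using a b bc by blast
qed

section \<open>Elementary automorphisms and canonical representatives\<close>

text \<open>The divisibility condition on \<open>d\<close> makes x_j \<mapsto> d x_j a homomorphism
  into the i-th factor, and \<open>u\<close> is a unit there. The alternative \<open>d = 0\<close>
  admits j = i, which gives pure scaling of one coordinate.\<close>

lemma fun_upd_in_G_orbit:
  assumes p: "prime p" and a: "a \<in> carrier (A_grp p lam)" and i: "i < length lam" and j: "j < length lam"
    and u: "\<not> int p dvd u" and d: "int p ^ (lam ! i) dvd d * int p ^ (lam ! j)" and ij: "j \<noteq> i \<or> d = 0"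
  shows "a(i := (u * a i + d * a j) mod int p ^ (lam ! i)) \<in> G_orbit p lam a"
proof -
  \<comment> \<open>Members of \<open>AutoGroup\<close> are extensional, hence the restriction to
    the carrier.\<close>
  define f where
    "f = (\<lambda>x\<in>carrier (A_grp p lam). x(i := (u * x i + d * x j) mod int p ^ (lam ! i)))"
  have pos: "0 < int p ^ k" for k using p by (simp add: prime_gt_0_nat)
  have closed: "f x \<in> carrier (A_grp p lam)" if "x \<in> carrier (A_grp p lam)" for x
    using that i pos by (auto simp: f_def carrier_A_grp[OF p] PiE_iff extensional_def)
  have "f \<in> hom (A_grp p lam) (A_grp p lam)"
  proof (rule homI)
    fix x y
    assume x: "x \<in> carrier (A_grp p lam)" and y: "y \<in> carrier (A_grp p lam)"
    let ?P = "int p ^ (lam ! i)" and ?Q = "int p ^ (lam ! j)"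
    have xy: "x \<otimes>\<^bsub>A_grp p lam\<^esub> y \<in> carrier (A_grp p lam)"
      using x y group_A_grp by (simp add: group.is_monoid monoid.m_closed)
    have "d * ((x j + y j) mod ?Q) mod ?P = d * (x j + y j) mod ?P"
      using mult_mod_cong_of_dvd[OF d] .
    then have "(u * ((x i + y i) mod ?P) + d * ((x j + y j) mod ?Q)) mod ?P =
        (u * (x i + y i) + d * (x j + y j)) mod ?P"
      by (intro mod_add_cong) (simp_all add: mod_mult_right_eq)
    then have e: "(u * ((x i + y i) mod ?P) + d * ((x j + y j) mod ?Q)) mod ?P =
        ((u * x i + d * x j) mod ?P + (u * y i + d * y j) mod ?P) mod ?P"
      unfolding mod_add_eq by (simp add: algebra_simps)
    show "f (x \<otimes>\<^bsub>A_grp p lam\<^esub> y) = f x \<otimes>\<^bsub>A_grp p lam\<^esub> f y"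
      using i j x y xy e by (auto simp: f_def mult_A_grp fun_eq_iff)
  qed (rule closed)
  moreover have "bij_betw f (carrier (A_grp p lam)) (carrier (A_grp p lam))"
  proof -
    have "inj_on f (carrier (A_grp p lam))"
    proof (rule inj_onI)
      fix x y
      assume x: "x \<in> carrier (A_grp p lam)" and y: "y \<in> carrier (A_grp p lam)" and eq: "f x = f y"
      have ne: "x l = y l" if "l \<noteq> i" for l
        using fun_cong[OF eq, of l] that x y by (simp add: f_def)
      \<comment> \<open>Either coordinate j was left unchanged or d = 0, so this term cancels; then
        the unit \<open>u\<close> can be cancelled.\<close>
      have dxy: "d * x j = d * y j" using ij ne by auto
      have "(u * x i + d * x j) mod int p ^ (lam ! i) = (u * y i + d * y j) mod int p ^ (lam ! i)"
        using fun_cong[OF eq, of i] x y by (simp add: f_def)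
      then have "int p ^ (lam ! i) dvd (x i - y i) * u"
        unfolding dxy by (simp add: mod_eq_dvd_iff algebra_simps)
      moreover have "coprime (int p ^ (lam ! i)) u"
        using p u by (simp add: prime_imp_coprime)
      ultimately have "int p ^ (lam ! i) dvd x i - y i"
        by (simp add: coprime_dvd_mult_left_iff)
      then have "x i mod int p ^ (lam ! i) = y i mod int p ^ (lam ! i)"
        by (simp add: mod_eq_dvd_iff)
      then have "x i = y i"
        using A_grp_range[OF p x i] A_grp_range[OF p y i] by simp
      with ne show "x = y" by (metis ext)
    qed
    \<comment> \<open>On a finite set injectivity yields surjectivity, so no inverse has to be
      constructed.\<close>
    moreover have "finite (carrier (A_grp p lam))"
      unfolding carrier_A_grp[OF p] by (intro finite_PiE) auto
    moreover have "f ` carrier (A_grp p lam) \<subseteq> carrier (A_grp p lam)"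
      using closed by blast
    ultimately show ?thesis
      using endo_inj_surj unfolding bij_betw_def by blast
  qed
  ultimately have "f \<in> carrier (AutoGroup (A_grp p lam))"
    by (simp add: AutoGroup_def auto_def Bij_def f_def)
  then show ?thesis
    using a unfolding G_orbit_def orbit_def by (intro CollectI exI[of _ f]) (simp add: f_def)
qed

(* The disjunct r = k makes the LEAST well defined; it yields p^k, which is 0 modulo p^k. *)
definition canon_exponent :: "nat \<Rightarrow> (nat \<times> nat) set \<Rightarrow> nat \<Rightarrow> nat" where
  "canon_exponent p I k = (LEAST r. r = k \<or> (p ^ r, k) \<in> I)"

definition canon_elt :: "nat \<Rightarrow> nat list \<Rightarrow> (nat \<times> nat) set \<Rightarrow> nat \<Rightarrow> int" where
  "canon_elt p lam I =
     (\<lambda>i\<in>{..<length lam}. int p ^ canon_exponent p I (lam ! i) mod int p ^ (lam ! i))"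

lemma canon_exponent_le: "canon_exponent p I k \<le> k"
  unfolding canon_exponent_def by (rule Least_le) simp

lemma canon_exponent_le_mem: "(p ^ r, k) \<in> I \<Longrightarrow> canon_exponent p I k \<le> r"
  unfolding canon_exponent_def by (rule Least_le) simp

lemma canon_exponent_mem:
  assumes "canon_exponent p I k < k"
  shows "(p ^ canon_exponent p I k, k) \<in> I"
  using LeastI[of "\<lambda>r. r = k \<or> (p ^ r, k) \<in> I" k] assms
  by (auto simp: canon_exponent_def)

lemma canon_elt_nth:
  assumes "prime p" "i < length lam"
  shows "canon_elt p lam I i =
    (if canon_exponent p I (lam ! i) < lam ! i then int p ^ canon_exponent p I (lam ! i) else 0)"
  using assms canon_exponent_le[of p I "lam ! i"] prime_gt_1_nat[OF assms(1)]
  by (auto simp: canon_elt_def le_less power_strict_increasing)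

lemma canon_elt_in_carrier:
  assumes "prime p"
  shows "canon_elt p lam I \<in> carrier (A_grp p lam)"
  using assms prime_gt_0_nat by (auto simp: canon_elt_def carrier_A_grp)

lemma coord_in_ideal_of_part:
  assumes p: "prime p" and a: "a \<in> carrier (A_grp p lam)" and i: "i < length lam"
    and "a i \<noteq> 0" "a i = int p ^ r * u" "\<not> int p dvd u"
  shows "(p ^ r, lam ! i) \<in> ideal_of_part p lam a"
  unfolding in_ideal_of_part_iff[OF p a]
  using coord_exponent_less[OF p a i assms(4,5)] assms(3-6)
  by (intro conjI exI[of _ i] exI[of _ r] exI[of _ u]) auto

text \<open>Minimality of the canonical exponent s makes a_i a multiple p^s w. If (p^s, lam_i) is in
  the ideal, some coordinate a_j = p^r u lies above it: for j = i, scaling by the inverse of u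
  suffices, and otherwise a multiple of a_j corrects p^s w to p^s.\<close>

lemma canon_update_in_G_orbit:
  assumes p: "prime p" and a: "a \<in> carrier (A_grp p lam)" and i: "i < length lam"
  shows "a(i := canon_elt p lam (ideal_of_part p lam a) i) \<in> G_orbit p lam a"
proof -
  define I where "I = ideal_of_part p lam a"
  define k where "k = lam ! i"
  define s where "s = canon_exponent p I k"
  have c: "canon_elt p lam I i = (if s < k then int p ^ s else 0)"
    using canon_elt_nth[OF p i] by (simp add: s_def k_def)
  have "\<exists>w. a i = int p ^ s * w"
  proof (cases "a i = 0")
    case False
    then obtain r u where ru: "a i = int p ^ r * u" "\<not> int p dvd u"
      using prime_power_decompose_int[OF p] by blast
    then have "s \<le> r"
      unfolding s_def I_def k_def
      by (intro canon_exponent_le_mem coord_in_ideal_of_part[OF p a i False])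
    then have "a i = int p ^ s * (int p ^ (r - s) * u)"
      by (simp add: ru flip: power_add mult.assoc)
    then show ?thesis by blast
  qed auto
  then obtain w where w: "a i = int p ^ s * w" by blast
  have red: "a i mod int p ^ k = a i"
    using A_grp_range[OF p a i] by (simp add: k_def)
  show ?thesis
  proof (cases "s < k")
    case False
    \<comment> \<open>No symbol with second entry \<open>k\<close> lies in the ideal, so both the
      old and the new coordinate are 0.\<close>
    then have "s = k" using canon_exponent_le[of p I k] by (simp add: s_def)
    then have "a i = 0" using red w by simp
    then have "a(i := canon_elt p lam I i) = a" using c False by auto
    then show ?thesis
      using G_orbit_refl[OF a] by (simp add: I_def)
  next
    case True
    then have "(p ^ s, k) \<in> ideal_of_part p lam a"
      using canon_exponent_mem by (simp add: s_def I_def)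
    then obtain j r u where j: "j < length lam" "a j \<noteq> 0" "a j = int p ^ r * u" "\<not> int p dvd u"
      "r \<le> s" "k + r \<le> lam ! j + s"
      using in_ideal_of_part_iff[OF p a] by blast
    have "coprime u (int p ^ k)"
      using p j(4) by (simp add: prime_imp_coprime coprime_commute[of u])
    \<comment> \<open>\<open>v\<close> is an inverse of \<open>u\<close> modulo p^k.\<close>
    then obtain v t where "v * u + t * int p ^ k = 1"
      using bezout_int[of u "int p ^ k"] by auto
    then have v: "u * v mod int p ^ k = 1 mod int p ^ k"
      by (metis mod_mult_self1 mult.commute)
    have ck: "int p ^ s mod int p ^ k = canon_elt p lam I i"
      using True c prime_gt_1_nat[OF p] by (simp add: power_strict_increasing)
    have uv: "x * (u * v) mod int p ^ k = x mod int p ^ k" for x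
      by (metis v mod_mult_right_eq mult.right_neutral)
    show ?thesis
    proof (cases "j = i")
      case True
      \<comment> \<open>The symbol of a_i itself is in the ideal, so minimality of \<open>s\<close>
        and r \<le> s give equality.\<close>
      then have "s \<le> r"
        using j unfolding s_def I_def k_def
        by (intro canon_exponent_le_mem coord_in_ideal_of_part[OF p a i]) auto
      then have "r = s" using j by simp
      have "\<not> int p dvd v"
      proof
        assume "int p dvd v"
        moreover have "int p dvd int p ^ k" using \<open>s < k\<close> by simp
        ultimately have "int p dvd 1"
          using v by (metis dvd_mod_iff dvd_mult)
        then show False using prime_gt_1_nat[OF p] by simp
      qed
      moreover have "(v * a i + 0 * a i) mod int p ^ k = canon_elt p lam I i"
        using uv[of "int p ^ s"] j True \<open>r = s\<close> ck by (simp add: mult_ac)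
      ultimately show ?thesis
        using fun_upd_in_G_orbit[OF p a i i, of v 0] by (simp add: k_def I_def)
    next
      case False
      \<comment> \<open>This choice gives d a_j = p^s (1 - w) modulo p^k, exactly what is missing
        from a_i = p^s w. The factor p^(s-r) makes it an admissible coefficient, since k + r \<le>
        lam_j + s.\<close>
      define d where "d = int p ^ (s - r) * v * (1 - w)"
      have "int p ^ k dvd int p ^ (s - r) * int p ^ (lam ! j)"
        using j by (simp add: le_imp_power_dvd flip: power_add)
      then have "int p ^ k dvd d * int p ^ (lam ! j)"
        unfolding d_def by (metis dvd_mult2 mult.assoc mult.commute)
      moreover have "(1 * a i + d * a j) mod int p ^ k = canon_elt p lam I i"
      proof -
        have "int p ^ s = int p ^ (s - r) * int p ^ r"
          using j by (simp flip: power_add)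
        then have "d * a j = int p ^ s * (1 - w) * (u * v)"
          by (simp add: d_def j(3) mult_ac)
        then have "(1 * a i + d * a j) mod int p ^ k = (a i + int p ^ s * (1 - w)) mod int p ^ k"
          by (metis uv mod_add_right_eq mult_1)
        then show ?thesis
          by (simp add: w algebra_simps ck)
      qed
      moreover have "\<not> int p dvd 1" using prime_gt_1_nat[OF p] by simp
      ultimately show ?thesis
        using fun_upd_in_G_orbit[OF p a i j(1), of 1 d] False by (simp add: k_def I_def)
    qed
  qed
qed

text \<open>Coordinates are replaced one at a time. The ideal is constant on the orbit, so the
  target \<open>?c\<close> stays the same throughout.\<close>

lemma canon_elt_in_G_orbit:
  assumes p: "prime p" and a: "a \<in> carrier (A_grp p lam)"
  shows "canon_elt p lam (ideal_of_part p lam a) \<in> G_orbit p lam a"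
proof -
  let ?c = "canon_elt p lam (ideal_of_part p lam a)"
  define b where "b m = (\<lambda>i. if i < m then ?c i else a i)" for m
  have "b m \<in> G_orbit p lam a" if "m \<le> length lam" for m
    using that
  proof (induction m)
    case 0
    show ?case
      using G_orbit_refl[OF a] by (simp add: b_def)
  next
    case (Suc m)
    then have b: "b m \<in> G_orbit p lam a" by simp
    then have "b m \<in> carrier (A_grp p lam)"
      using a by (auto elim: G_orbitE)
    then have "(b m)(m := ?c m) \<in> G_orbit p lam (b m)"
      using canon_update_in_G_orbit[OF p, of "b m" lam m] ideal_of_part_orbit[OF p a b] Suc.prems by simp
    moreover have "(b m)(m := ?c m) = b (Suc m)"
      by (auto simp: b_def fun_eq_iff less_Suc_eq)
    ultimately show ?case
      using G_orbit_eq[OF a b] by simp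
  qed
  from this[of "length lam"] have "b (length lam) \<in> G_orbit p lam a" by simp
  \<comment> \<open>Beyond the index range both functions are \<open>undefined\<close>.\<close>
  moreover have "b (length lam) = ?c"
    using a by (auto simp: b_def fun_eq_iff canon_elt_def carrier_A_grp[OF p] PiE_iff extensional_def)
  ultimately show ?thesis by simp
qed

text \<open>Each orbit contains the canonical element of its ideal, so equal ideals force a common
  member.\<close>

lemma G_orbit_eq_iff_ideal_of_part_eq:
  assumes p: "prime p" and a: "a \<in> carrier (A_grp p lam)" and b: "b \<in> carrier (A_grp p lam)"
  shows "G_orbit p lam a = G_orbit p lam b \<longleftrightarrow> ideal_of_part p lam a = ideal_of_part p lam b"
proof
  assume "G_orbit p lam a = G_orbit p lam b"
  then have "a \<in> G_orbit p lam b"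
    using G_orbit_refl[OF a] by simp
  then show "ideal_of_part p lam a = ideal_of_part p lam b"
    by (rule ideal_of_part_orbit[OF p b])
next
  assume "ideal_of_part p lam a = ideal_of_part p lam b"
  then show "G_orbit p lam a = G_orbit p lam b"
    using G_orbit_eq[OF a canon_elt_in_G_orbit[OF p a]] G_orbit_eq[OF b canon_elt_in_G_orbit[OF p b]]
    by simp
qed

section \<open>Degeneration as inclusion of ideals\<close>

lemma degenerates_trans:
  assumes "degenerates A a B b" "degenerates B b C c"
  shows "degenerates A a C c"
proof -
  obtain g h where "g \<in> hom A B" "g a = b" "h \<in> hom B C" "h b = c"
    using assms unfolding degenerates_def by blast
  then have "h \<circ> g \<in> hom A C" "(h \<circ> g) a = c"
    by (auto intro: hom_compose)
  then show ?thesis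
    unfolding degenerates_def by blast
qed

text \<open>Enlarging an ideal can only lower the least exponents, so multiplying coordinate i by
  p^(e_i) raises those of \<open>J\<close> to those of \<open>I\<close>. Source and target
  coordinates have the same modulus, so any scalars define a homomorphism.\<close>

lemma degenerates_canon_elt:
  assumes p: "prime p" and "I \<subseteq> J"
  shows "degenerates (A_grp p lam) (canon_elt p lam J) (A_grp p lam) (canon_elt p lam I)"
proof -
  define e where "e i = canon_exponent p I (lam ! i) - canon_exponent p J (lam ! i)" for i
  define h where "h x = (\<lambda>i\<in>{..<length lam}. int p ^ e i * x i mod int p ^ (lam ! i))" for x
  have le: "canon_exponent p J k \<le> canon_exponent p I k" for k
  proof (cases "canon_exponent p I k < k")
    case True
    then show ?thesis
      using canon_exponent_mem assms(2) by (blast intro: canon_exponent_le_mem)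
  next
    case False
    then show ?thesis
      using canon_exponent_le[of p J k] by simp
  qed
  have "h \<in> hom (A_grp p lam) (A_grp p lam)"
  proof (rule homI)
    show "h x \<in> carrier (A_grp p lam)" for x
      using p prime_gt_0_nat by (auto simp: h_def carrier_A_grp)
    show "h (x \<otimes>\<^bsub>A_grp p lam\<^esub> y) = h x \<otimes>\<^bsub>A_grp p lam\<^esub> h y" for x y
      by (auto simp: h_def mult_A_grp fun_eq_iff mod_simps distrib_left)
  qed
  moreover have "h (canon_elt p lam J) = canon_elt p lam I"
    using le by (auto simp: h_def canon_elt_def fun_eq_iff e_def mod_simps simp flip: power_add)
  ultimately show ?thesis
    unfolding degenerates_def by blast
qed

lemma degenerates_G_orbit:
  assumes "a \<in> carrier (A_grp p lam)" "b \<in> G_orbit p lam a"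
  shows "degenerates (A_grp p lam) a (A_grp p lam) b"
proof -
  obtain h where "h \<in> hom (A_grp p lam) (A_grp p lam)" "b = h a"
    using assms(2,1) by (rule G_orbitE)
  then show ?thesis
    unfolding degenerates_def by blast
qed

text \<open>For the converse of monotonicity, \<open>a\<close> degenerates to \<open>b\<close>
  through the chain \<open>a\<close>, \<open>?ca\<close>, \<open>?cb\<close>, \<open>b\<close>,
  whose outer links are automorphisms.\<close>

lemma degenerates_iff_ideal_of_part_subset:
  assumes p: "prime p" and a: "a \<in> carrier (A_grp p lam)" and b: "b \<in> carrier (A_grp p lam)"
  shows "degenerates (A_grp p lam) a (A_grp p lam) b \<longleftrightarrow>
    ideal_of_part p lam b \<subseteq> ideal_of_part p lam a"
proof
  assume "degenerates (A_grp p lam) a (A_grp p lam) b"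
  then show "ideal_of_part p lam b \<subseteq> ideal_of_part p lam a"
    using ideal_of_part_hom_mono[OF p a] by (auto simp: degenerates_def)
next
  let ?ca = "canon_elt p lam (ideal_of_part p lam a)"
  let ?cb = "canon_elt p lam (ideal_of_part p lam b)"
  assume "ideal_of_part p lam b \<subseteq> ideal_of_part p lam a"
  then have "degenerates (A_grp p lam) ?ca (A_grp p lam) ?cb"
    by (rule degenerates_canon_elt[OF p])
  moreover have "degenerates (A_grp p lam) a (A_grp p lam) ?ca"
    using degenerates_G_orbit[OF a] canon_elt_in_G_orbit[OF p a] .
  moreover have "b \<in> G_orbit p lam ?cb"
    unfolding G_orbit_eq[OF b canon_elt_in_G_orbit[OF p b]] by (rule G_orbit_refl[OF b])
  then have "degenerates (A_grp p lam) ?cb (A_grp p lam) b"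
    by (rule degenerates_G_orbit[OF canon_elt_in_carrier[OF p]])
  ultimately show "degenerates (A_grp p lam) a (A_grp p lam) b"
    by (blast intro: degenerates_trans)
qed

text \<open>Ideals are constant on orbits, so all pairs of representatives agree on degeneration and
  the existential choice in \<open>orbit_ge\<close> is harmless.\<close>

lemma orbit_ge_iff:
  assumes p: "prime p" and a: "a \<in> carrier (A_grp p lam)" and b: "b \<in> carrier (A_grp p lam)"
  shows "orbit_ge p lam (G_orbit p lam a) (G_orbit p lam b) \<longleftrightarrow>
    ideal_of_part p lam b \<subseteq> ideal_of_part p lam a"
proof -
  have "degenerates (A_grp p lam) x (A_grp p lam) y \<longleftrightarrow>
      ideal_of_part p lam b \<subseteq> ideal_of_part p lam a"
    if "x \<in> G_orbit p lam a" "y \<in> G_orbit p lam b" for x y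
  proof -
    have "x \<in> carrier (A_grp p lam)" "y \<in> carrier (A_grp p lam)"
      using that a b by (auto elim: G_orbitE)
    then show ?thesis
      using degenerates_iff_ideal_of_part_subset[OF p] ideal_of_part_orbit[OF p a that(1)]
        ideal_of_part_orbit[OF p b that(2)] by simp
  qed
  moreover have "a \<in> G_orbit p lam a" "b \<in> G_orbit p lam b"
    using G_orbit_refl a b by auto
  ultimately show ?thesis
    unfolding orbit_ge_def by blast
qed

section \<open>Ideals of elements are exactly the ideals of the poset\<close>

lemma ideal_of_part_in_J_lattice:
  assumes p: "prime p" and a: "a \<in> carrier (A_grp p lam)"
  shows "ideal_of_part p lam a \<in> J_lattice p lam"
proof -
  have "y \<in> ideal_of_part p lam a"
    if x: "x \<in> ideal_of_part p lam a" and y: "y \<in> fund_poset_part p lam" and xy: "fund_ge p x y" for x y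
  proof -
    obtain r k where xe: "x = (p ^ r, k)" "r < k"
      using x by (auto simp: ideal_of_part_def fund_poset_part_def fund_poset_def)
    obtain s l where ye: "y = (p ^ s, l)" "s < l" "l \<in> set lam"
      using y by (auto simp: fund_poset_part_def fund_poset_def)
    have "r \<le> s" "l + r \<le> k + s"
      using xy fund_ge_iff[OF p xe(2) ye(2)] xe ye by auto
    then show ?thesis
      using x ye(2,3) unfolding xe(1) ye(1) in_ideal_of_part_iff[OF p a] by fastforce
  qed
  then show ?thesis
    by (auto simp: J_lattice_def is_ideal_def ideal_of_part_def)
qed

text \<open>Each non-zero coordinate of \<open>?c\<close> contributes a symbol of \<open>I\<close>,
  and any (p^s, l) in \<open>I\<close> lies below the symbol (p^t, l) contributed by a coordinate
  with lam_j = l, since the least exponent t is at most s. This gives surjectivity onto the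
  ideals.\<close>

lemma ideal_of_part_canon_elt:
  assumes p: "prime p" and I: "I \<in> J_lattice p lam"
  shows "ideal_of_part p lam (canon_elt p lam I) = I"
proof -
  let ?c = "canon_elt p lam I"
  have c: "?c \<in> carrier (A_grp p lam)"
    by (rule canon_elt_in_carrier[OF p])
  have sub: "I \<subseteq> fund_poset_part p lam" and
    down: "\<And>x y. \<lbrakk>x \<in> I; y \<in> fund_poset_part p lam; fund_ge p x y\<rbrakk> \<Longrightarrow> y \<in> I"
    using I by (auto simp: J_lattice_def is_ideal_def)
  have p_not: "\<not> int p dvd 1" using prime_gt_1_nat[OF p] by simp
  have iff: "(p ^ s, l) \<in> ideal_of_part p lam ?c \<longleftrightarrow> (p ^ s, l) \<in> I" if s: "s < l" and l: "l \<in> set lam" for s l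
  proof
    assume "(p ^ s, l) \<in> ideal_of_part p lam ?c"
    then obtain j r u where j: "j < length lam" "?c j \<noteq> 0" "?c j = int p ^ r * u" "\<not> int p dvd u"
      "r \<le> s" "l + r \<le> lam ! j + s"
      using in_ideal_of_part_iff[OF p c] by blast
    define t where "t = canon_exponent p I (lam ! j)"
    have t: "t < lam ! j" "?c j = int p ^ t * 1"
      using canon_elt_nth[OF p j(1)] j(2) by (auto simp: t_def split: if_splits)
    \<comment> \<open>Comparing the two factorizations of the same coordinate gives
      \<open>t = r\<close>.\<close>
    then have "t \<le> r"
      using prime_power_dvd_power_times_iff[OF p j(4), of t r] j(3) by (metis dvd_triv_left)
    moreover have "r \<le> t"
      using prime_power_dvd_power_times_iff[OF p p_not, of r t] j(3) t by (metis dvd_triv_left)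
    ultimately have "fund_ge p (p ^ t, lam ! j) (p ^ s, l)"
      using fund_ge_iff[OF p t(1) s] j by simp
    moreover have "(p ^ t, lam ! j) \<in> I"
      using canon_exponent_mem t(1) by (simp add: t_def)
    moreover have "(p ^ s, l) \<in> fund_poset_part p lam"
      using s l by (auto simp: fund_poset_part_def fund_poset_def)
    ultimately show "(p ^ s, l) \<in> I"
      using down by blast
  next
    assume mem: "(p ^ s, l) \<in> I"
    obtain j where j: "j < length lam" "lam ! j = l"
      using l by (auto simp: in_set_conv_nth)
    define t where "t = canon_exponent p I l"
    have "t \<le> s" using canon_exponent_le_mem[OF mem] by (simp add: t_def)
    then have "?c j = int p ^ t * 1" "?c j \<noteq> 0"
      using canon_elt_nth[OF p j(1)] s prime_gt_0_nat[OF p] by (auto simp: t_def j)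
    then show "(p ^ s, l) \<in> ideal_of_part p lam ?c"
      unfolding in_ideal_of_part_iff[OF p c] using s l j \<open>t \<le> s\<close> p_not
      by (intro conjI exI[of _ j] exI[of _ t] exI[of _ 1]) auto
  qed
  have "x \<in> ideal_of_part p lam ?c \<longleftrightarrow> x \<in> I" if x: "x \<in> fund_poset_part p lam" for x
  proof -
    obtain s l where "x = (p ^ s, l)" "s < l" "l \<in> set lam"
      using x unfolding fund_poset_part_def fund_poset_def by blast
    then show ?thesis using iff by simp
  qed
  moreover have "ideal_of_part p lam ?c \<subseteq> fund_poset_part p lam"
    by (simp add: ideal_of_part_def)
  ultimately show ?thesis
    using sub by blast
qed

section \<open>The isomorphism between orbits and ideals\<close>

text \<open>The first conjunct expresses that degeneration is independent of representatives. In the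
  second, pairs are reversed because a pair in a HOL order relation reads as smaller before
  larger.\<close>

theorem theorem5p4:
  fixes p :: nat and lam :: "nat list"
  assumes "prime p" and "is_partition lam"
  shows
    "(\<forall>a\<in>carrier (A_grp p lam). \<forall>b\<in>carrier (A_grp p lam).
       orbit_ge p lam (G_orbit p lam a) (G_orbit p lam b) \<longleftrightarrow>
       degenerates (A_grp p lam) a (A_grp p lam) b) \<and>
     partial_order_on (G_orbits p lam)
       {(Y, X). X \<in> G_orbits p lam \<and> Y \<in> G_orbits p lam \<and> orbit_ge p lam X Y} \<and>
     (\<exists>\<phi>. (\<forall>a\<in>carrier (A_grp p lam). \<phi> (G_orbit p lam a) = ideal_of_part p lam a) \<and>
       bij_betw \<phi> (G_orbits p lam) (J_lattice p lam) \<and>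
       (\<forall>X\<in>G_orbits p lam. \<forall>Y\<in>G_orbits p lam. orbit_ge p lam X Y \<longleftrightarrow> \<phi> Y \<subseteq> \<phi> X))"
proof -
  note p = assms(1)
  let ?A = "carrier (A_grp p lam)"
  \<comment> \<open>A representative is chosen for each orbit; invariance of the ideal makes the
    choice immaterial.\<close>
  define \<phi> where "\<phi> X = ideal_of_part p lam (SOME a. a \<in> ?A \<and> G_orbit p lam a = X)" for X
  have orbits: "G_orbits p lam = G_orbit p lam ` ?A"
    by (auto simp: G_orbits_def orbits_def G_orbit_def)
  have \<phi>: "\<phi> (G_orbit p lam a) = ideal_of_part p lam a" if "a \<in> ?A" for a
    unfolding \<phi>_def
    by (rule someI2[of _ a]) (use that G_orbit_eq_iff_ideal_of_part_eq[OF p] in auto)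
  have ge: "orbit_ge p lam X Y \<longleftrightarrow> \<phi> Y \<subseteq> \<phi> X" if "X \<in> G_orbits p lam" "Y \<in> G_orbits p lam" for X Y
    using that orbit_ge_iff[OF p] \<phi> by (auto simp: orbits)
  have inj: "inj_on \<phi> (G_orbits p lam)"
    unfolding orbits by (rule inj_onI) (auto simp: \<phi> simp flip: G_orbit_eq_iff_ideal_of_part_eq[OF p])
  moreover have "\<phi> ` G_orbits p lam = J_lattice p lam"
  proof
    show "\<phi> ` G_orbits p lam \<subseteq> J_lattice p lam"
      using ideal_of_part_in_J_lattice[OF p] \<phi> by (auto simp: orbits)
    show "J_lattice p lam \<subseteq> \<phi> ` G_orbits p lam"
    proof
      fix I
      assume "I \<in> J_lattice p lam"
      then have "I = \<phi> (G_orbit p lam (canon_elt p lam I))"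
        by (simp add: \<phi> canon_elt_in_carrier[OF p] ideal_of_part_canon_elt[OF p])
      then show "I \<in> \<phi> ` G_orbits p lam"
        unfolding orbits using canon_elt_in_carrier[OF p] by blast
    qed
  qed
  ultimately have bij: "bij_betw \<phi> (G_orbits p lam) (J_lattice p lam)"
    by (simp add: bij_betw_def)
  \<comment> \<open>The order is pulled back from inclusion along \<open>\<phi>\<close>:
    \<open>ge\<close> supplies reflexivity and transitivity, and injectivity supplies
    antisymmetry.\<close>
  have "partial_order_on (G_orbits p lam)
      {(Y, X). X \<in> G_orbits p lam \<and> Y \<in> G_orbits p lam \<and> orbit_ge p lam X Y}"
    unfolding partial_order_on_def preorder_on_def
  proof (intro conjI refl_onI transI antisymI)
    fix X Y Z
    assume "(X, Y) \<in> {(Y, X). X \<in> G_orbits p lam \<and> Y \<in> G_orbits p lam \<and> orbit_ge p lam X Y}"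
      "(Y, Z) \<in> {(Y, X). X \<in> G_orbits p lam \<and> Y \<in> G_orbits p lam \<and> orbit_ge p lam X Y}"
    then show "(X, Z) \<in> {(Y, X). X \<in> G_orbits p lam \<and> Y \<in> G_orbits p lam \<and> orbit_ge p lam X Y}"
      using ge by blast
  next
    fix X Y
    assume "(X, Y) \<in> {(Y, X). X \<in> G_orbits p lam \<and> Y \<in> G_orbits p lam \<and> orbit_ge p lam X Y}"
      "(Y, X) \<in> {(Y, X). X \<in> G_orbits p lam \<and> Y \<in> G_orbits p lam \<and> orbit_ge p lam X Y}"
    then have "X \<in> G_orbits p lam" "Y \<in> G_orbits p lam" "\<phi> X = \<phi> Y"
      using ge by auto
    then show "X = Y"
      using inj by (auto dest: inj_onD)
  qed (use ge in auto)
  moreover have "orbit_ge p lam (G_orbit p lam a) (G_orbit p lam b) \<longleftrightarrow>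
      degenerates (A_grp p lam) a (A_grp p lam) b" if "a \<in> ?A" "b \<in> ?A" for a b
    using orbit_ge_iff[OF p that] degenerates_iff_ideal_of_part_subset[OF p that] by simp
  ultimately show ?thesis
    by (intro conjI exI[of _ \<phi>] ballI) (simp_all only: \<phi> bij ge)
qed

end
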